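(* Let $G=(V,E)$ be a connected locally finite graph and let $\mathbf{w}:V\to(0,\infty)$ be a weight function taking values in $\lambda^{\mathbb{Z}}=\{\lambda^n:n\in\mathbb{Z}\}$ for some $\lambda>1$. Then as $\beta\to\infty$ the local limit of $\mathfrak{F}_\beta(G,\boldsymbol{U})$ exists and is given by $\mathrm{FMaxSF}(G,\boldsymbol{U})$.
   Context: $\boldsymbol{U}=(U_e)_{e\in E}$ are i.i.d. $\mathrm{Uniform}[0,1]$ labels. For an edge $e=(x,y)$ put $\mathbf{w}(e)=\min\{\mathbf{w}(x),\mathbf{w}(y)\}$ and, for $\beta\in[0,\infty)$, $X_{e,\beta}=\mathbf{w}(e)^\beta(1-U_e)$. Define orders on $E$: $e\prec_{\mathbf{w}}e'$ iff $\mathbf{w}(e)<\mathbf{w}(e')$, or $\mathbf{w}(e)=\mathbf{w}(e')$ and $1-U_e<1-U_{e'}$; $e\prec_\beta e'$ iff $X_{e,\beta}<X_{e',\beta}$, or $X_{e,\beta}=X_{e',\beta}$ and $1-U_e<1-U_{e'}$. Almost surely these are linear orders for all $\beta\ge0$ simultaneously. $\mathrm{FMaxSF}(G,\boldsymbol{U})$ (resp. $\mathfrak{F}_\beta(G,\boldsymbol{U})$) is the forest obtained from $G$ by simultaneously deleting the $\prec_{\mathbf{w}}$-least (resp. $\prec_\beta$-least) edge in every finite cycle. Local limit as $\beta\to\infty$ means almost sure limit in the product topology on $2^E$: almost surely, for every finite set of edges $K$, the forest agrees with the limit on $K$ for all sufficiently large $\beta$ (all forests use the same labels $\boldsymbol{U}$).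 *)

theory Defs
  imports "HOL-Probability.Probability"
begin

text \<open>Simple undirected graphs, possibly infinite: a vertex set and a set of two-element
  edges.\<close>

definition simple_graph :: "'v set \<Rightarrow> 'v set set \<Rightarrow> bool" where
  "simple_graph V E \<longleftrightarrow> (\<forall>e\<in>E. e \<subseteq> V \<and> card e = 2)"

definition connected_graph :: "'v set \<Rightarrow> 'v set set \<Rightarrow> bool" where
  "connected_graph V E \<longleftrightarrow> (\<forall>x\<in>V. \<forall>y\<in>V. (\<lambda>a b. {a, b} \<in> E)\<^sup>*\<^sup>* x y)"

definition locally_finite_graph :: "'v set \<Rightarrow> 'v set set \<Rightarrow> bool" where
  "locally_finite_graph V E \<longleftrightarrow> (\<forall>v\<in>V. finite {e\<in>E. v \<in> e})"

text \<open>A finite cycle is given by the cyclic list of its distinct vertices, and is identified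
  with its set of edges.\<close>

definition cyclic_edges :: "'v list \<Rightarrow> 'v set set" where
  "cyclic_edges vs = {{vs ! i, vs ! (Suc i mod length vs)} | i. i < length vs}"

definition finite_cycle :: "'v set set \<Rightarrow> 'v set set \<Rightarrow> bool" where
  "finite_cycle E C \<longleftrightarrow>
     (\<exists>vs. length vs \<ge> 3 \<and> distinct vs \<and> C = cyclic_edges vs \<and> C \<subseteq> E)"

definition edge_weight :: "('v \<Rightarrow> real) \<Rightarrow> 'v set \<Rightarrow> real" where
  "edge_weight w e = Min (w ` e)"

definition X_beta :: "('v \<Rightarrow> real) \<Rightarrow> ('v set \<Rightarrow> real) \<Rightarrow> real \<Rightarrow> 'v set \<Rightarrow> real" where
  "X_beta w u \<beta> e = edge_weight w e powr \<beta> * (1 - u e)"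

definition prec_w :: "('v \<Rightarrow> real) \<Rightarrow> ('v set \<Rightarrow> real) \<Rightarrow> 'v set \<Rightarrow> 'v set \<Rightarrow> bool" where
  "prec_w w u e e' \<longleftrightarrow> edge_weight w e < edge_weight w e' \<or>
     edge_weight w e = edge_weight w e' \<and> 1 - u e < 1 - u e'"

definition prec_beta ::
    "('v \<Rightarrow> real) \<Rightarrow> ('v set \<Rightarrow> real) \<Rightarrow> real \<Rightarrow> 'v set \<Rightarrow> 'v set \<Rightarrow> bool" where
  "prec_beta w u \<beta> e e' \<longleftrightarrow> X_beta w u \<beta> e < X_beta w u \<beta> e' \<or>
     X_beta w u \<beta> e = X_beta w u \<beta> e' \<and> 1 - u e < 1 - u e'"

text \<open>Forests are spanning subgraphs, represented by their edge sets. The relation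
  \<open>prec\<close> is a strict order; when it is not linear (a null event for the
  orders used here), a cycle without a least edge causes no deletion.\<close>

definition cycle_deletion :: "'v set set \<Rightarrow> ('v set \<Rightarrow> 'v set \<Rightarrow> bool) \<Rightarrow> 'v set set" where
  "cycle_deletion E prec =
     {e\<in>E. \<not> (\<exists>C. finite_cycle E C \<and> e \<in> C \<and> (\<forall>f\<in>C - {e}. prec e f))}"

definition FMaxSF :: "'v set set \<Rightarrow> ('v \<Rightarrow> real) \<Rightarrow> ('v set \<Rightarrow> real) \<Rightarrow> 'v set set" where
  "FMaxSF E w u = cycle_deletion E (prec_w w u)"

definition F_beta ::
    "'v set set \<Rightarrow> ('v \<Rightarrow> real) \<Rightarrow> real \<Rightarrow> ('v set \<Rightarrow> real) \<Rightarrow> 'v set set" where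
  "F_beta E w \<beta> u = cycle_deletion E (prec_beta w u \<beta>)"

definition iid_uniform_labels :: "'s measure \<Rightarrow> 'e set \<Rightarrow> ('e \<Rightarrow> 's \<Rightarrow> real) \<Rightarrow> bool" where
  "iid_uniform_labels M E U \<longleftrightarrow> prob_space.indep_vars M (\<lambda>_. borel) U E \<and>
     (\<forall>e\<in>E. distr M borel (U e) = uniform_measure lborel {0..1})"

text \<open>Almost sure convergence in the product topology on subsets of \<open>E\<close>; the null set
  is independent of \<open>K\<close> and \<open>\<beta>\<close>.\<close>

definition as_local_limit ::
    "'s measure \<Rightarrow> 'e set \<Rightarrow> (real \<Rightarrow> 's \<Rightarrow> 'e set) \<Rightarrow> ('s \<Rightarrow> 'e set) \<Rightarrow> bool" where
  "as_local_limit M E F L \<longleftrightarrow>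
     (AE \<omega> in M. \<forall>K. finite K \<and> K \<subseteq> E \<longrightarrow> (\<forall>\<^sub>F \<beta> in at_top. F \<beta> \<omega> \<inter> K = L \<omega> \<inter> K))"

end

theory Submission
  imports Defs "HOL-Real_Asymp.Real_Asymp"
begin

text \<open>Write \<open>Z f = 1 - U f\<close>, and \<open>w f\<close> for the weight of an edge \<open>f\<close>. Almost surely \<open>Z f\<close> lies in \<open>(0, 1]\<close> for every edge \<open>f\<close>, since a
  connected locally finite graph has only countably many edges. The rest of the argument is
  deterministic, and fixes such a realisation and one edge \<open>e\<close>.

  If \<open>w e < w f\<close>, then \<open>w e powr \<beta> * Z e < w f powr \<beta> * Z f\<close> for all large \<open>\<beta>\<close>, so each
  comparison \<open>prec_w e f\<close> is eventually inherited by \<open>prec_beta\<close>. How large \<open>\<beta>\<close> must be depends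
  on \<open>f\<close>, but a cycle witnessing that \<open>e\<close> is absent from the limit has finitely many edges
  (\<open>eventually_prec_beta_of_prec_w\<close>).

  For the converse the witnessing cycle may change with \<open>\<beta>\<close>, so a threshold is needed that does
  not depend on \<open>f\<close>. This is where the discreteness of the weights enters: if \<open>w f < w e\<close>, then
  even \<open>lam * w f \<le> w e\<close>, and as \<open>Z f \<le> 1\<close>, any \<open>\<beta>\<close> with \<open>lam powr \<beta> * Z e > 1\<close> rules out
  \<open>prec_beta e f\<close> for all such \<open>f\<close> at once. Beyond that threshold \<open>prec_beta e f\<close> implies
  \<open>prec_w e f\<close> for every \<open>f\<close> (\<open>eventually_prec_w_of_prec_beta\<close>), so a cycle that deletes \<open>e\<close> from
  the forest at \<open>\<beta>\<close> also deletes it from the limit.\<close>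

section \<open>Edges and their weights\<close>

lemma countable_edges:
  assumes "simple_graph V E" "connected_graph V E" "locally_finite_graph V E"
  shows "countable E"
proof (cases "V = {}")
  case True
  then have "E \<subseteq> {{}}" using assms(1) by (auto simp: simple_graph_def)
  then show ?thesis by (meson countable_finite finite.intros finite_subset)
next
  case False
  then obtain x where x: "x \<in> V" by blast
  define R where "R = {(a, b). {a, b} \<in> E}"
  have star: "(\<lambda>a b. {a, b} \<in> E)\<^sup>*\<^sup>* = (\<lambda>a b. (a, b) \<in> R\<^sup>*)"
    by (simp add: R_def fun_eq_iff rtranclp_rtrancl_eq)
  have inc: "countable {e\<in>E. v \<in> e}" for v
  proof (cases "v \<in> V")
    case True
    then show ?thesis using assms(3) by (simp add: locally_finite_graph_def countable_finite)
  next
    case False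
    then have "{e\<in>E. v \<in> e} = {}" using assms(1) by (auto simp: simple_graph_def)
    then show ?thesis by (metis countable_empty)
  qed
  have edge_countable: "countable e" if "e \<in> E" for e
    using that assms(1) by (metis simple_graph_def card.infinite countable_finite zero_neq_numeral)
  have "countable (R `` Y)" if "countable Y" for Y
  proof (rule countable_subset)
    show "R `` Y \<subseteq> (\<Union>v\<in>Y. \<Union>e\<in>{e\<in>E. v \<in> e}. e)" by (auto simp: R_def)
    show "countable (\<Union>v\<in>Y. \<Union>e\<in>{e\<in>E. v \<in> e}. e)"
      using that inc edge_countable by (intro countable_UN) auto
  qed
  then have "countable (R\<^sup>* `` {x})" by (intro countable_rtrancl) auto
  moreover have "V \<subseteq> R\<^sup>* `` {x}"
    using assms(2) x unfolding connected_graph_def star by auto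
  ultimately have "countable V" by (rule countable_subset[rotated])
  then have "countable (\<Union>v\<in>V. {e\<in>E. v \<in> e})" using inc by (intro countable_UN) auto
  moreover have "E \<subseteq> (\<Union>v\<in>V. {e\<in>E. v \<in> e})"
  proof
    fix e assume "e \<in> E"
    then have "e \<subseteq> V" "e \<noteq> {}" using assms(1) by (auto simp: simple_graph_def)
    then show "e \<in> (\<Union>v\<in>V. {e\<in>E. v \<in> e})" using \<open>e \<in> E\<close> by blast
  qed
  ultimately show ?thesis by (rule countable_subset[rotated])
qed

lemma edge_weight_attained:
  assumes "simple_graph V E" "e \<in> E"
  obtains v where "v \<in> V" "edge_weight w e = w v"
proof -
  have "finite e" "e \<noteq> {}" "e \<subseteq> V"
    using assms by (auto simp: simple_graph_def intro: card_ge_0_finite)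
  then have "Min (w ` e) \<in> w ` e" by (intro Min_in) auto
  then show ?thesis using that \<open>e \<subseteq> V\<close> by (auto simp: edge_weight_def)
qed

lemma powi_less_imp_mult_le:
  fixes a :: real
  assumes "a > 1" "a powi m < a powi n"
  shows "a * a powi m \<le> a powi n"
proof -
  have "m < n"
    using assms power_int_increasing[of n m a] by (meson less_imp_le not_less)
  then have "a powi (m + 1) \<le> a powi n"
    using assms by (intro power_int_increasing) auto
  then show ?thesis using assms by (simp add: power_int_add mult.commute)
qed

lemma finite_cycle_imp_finite: "finite_cycle E C \<Longrightarrow> finite C"
  by (auto simp: finite_cycle_def cyclic_edges_def)

section \<open>Comparing the two orders for large parameters\<close>

lemma eventually_less_powr_mult:
  fixes a b z :: real
  assumes "a > 1" "z > 0"
  shows "\<forall>\<^sub>F \<beta> in at_top. b < a powr \<beta> * z"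
proof -
  have "filterlim (\<lambda>\<beta>. a powr \<beta>) at_top at_top"
    using assms(1) by real_asymp
  then have "\<forall>\<^sub>F \<beta> in at_top. b / z < a powr \<beta>"
    by (simp add: filterlim_at_top_dense)
  then show ?thesis
    by eventually_elim (use assms(2) in \<open>simp add: field_simps\<close>)
qed

text \<open>If \<open>f\<close> is heavier than \<open>e\<close>, the ratio of the weights raised to the power \<open>\<beta>\<close> outgrows any fixed
  ratio of labels; if the weights are equal, the labels decide in both orders.\<close>

lemma eventually_prec_beta_of_prec_w:
  assumes pos: "edge_weight w e > 0" and uf: "u f < 1" and prec: "prec_w w u e f"
  shows "\<forall>\<^sub>F \<beta> in at_top. prec_beta w u \<beta> e f"
proof (cases "edge_weight w e < edge_weight w f")
  case True
  let ?a = "edge_weight w f / edge_weight w e"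
  have "\<forall>\<^sub>F \<beta> in at_top. 1 - u e < ?a powr \<beta> * (1 - u f)"
    using True pos uf by (intro eventually_less_powr_mult) auto
  then show ?thesis
  proof eventually_elim
    case (elim \<beta>)
    have "edge_weight w e powr \<beta> * (1 - u e)
        < edge_weight w e powr \<beta> * (?a powr \<beta> * (1 - u f))"
      using elim pos by (intro mult_strict_left_mono) auto
    also have "\<dots> = edge_weight w f powr \<beta> * (1 - u f)"
      using True pos by (simp add: powr_divide)
    finally show ?case by (simp add: prec_beta_def X_beta_def)
  qed
next
  case False
  then show ?thesis
    using prec pos by (auto simp: prec_w_def prec_beta_def X_beta_def)
qed

text \<open>The threshold for \<open>\<beta>\<close> depends on \<open>e\<close> only, because the gap in weights to any lighter edge
  is at least a factor \<open>lam\<close> and \<open>1 - u f\<close> never exceeds 1.\<close>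

lemma eventually_prec_w_of_prec_beta:
  assumes lam: "lam > 1" and pos: "\<And>f. f \<in> E \<Longrightarrow> edge_weight w f > 0"
    and gap: "\<And>f. f \<in> E \<Longrightarrow> edge_weight w f < edge_weight w e
        \<Longrightarrow> lam * edge_weight w f \<le> edge_weight w e"
    and u0: "\<And>f. f \<in> E \<Longrightarrow> u f \<ge> 0" and ue: "u e < 1" and e: "e \<in> E"
  shows "\<forall>\<^sub>F \<beta> in at_top. \<forall>f\<in>E. prec_beta w u \<beta> e f \<longrightarrow> prec_w w u e f"
proof -
  have "\<forall>\<^sub>F \<beta> in at_top. 1 < lam powr \<beta> * (1 - u e)"
    using lam ue by (intro eventually_less_powr_mult) auto
  then show ?thesis
    using eventually_ge_at_top[of 0]
  proof eventually_elim
    case (elim \<beta>)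
    show ?case
    proof (intro ballI impI)
      fix f assume f: "f \<in> E" and prec: "prec_beta w u \<beta> e f"
      let ?e = "edge_weight w e" and ?f = "edge_weight w f"
      have "\<not> ?f < ?e"
      proof
        assume "?f < ?e"
        have "X_beta w u \<beta> f \<le> ?f powr \<beta> * 1"
          unfolding X_beta_def using u0[OF f] by (intro mult_left_mono) auto
        also have "\<dots> < ?f powr \<beta> * (lam powr \<beta> * (1 - u e))"
          using elim(1) pos[OF f] by (intro mult_strict_left_mono) auto
        also have "\<dots> = (lam * ?f) powr \<beta> * (1 - u e)"
          using lam pos[OF f] by (simp add: powr_mult)
        also have "\<dots> \<le> ?e powr \<beta> * (1 - u e)"
          using gap[OF f \<open>?f < ?e\<close>] elim(2) lam pos[OF f] ue
          by (intro mult_right_mono powr_mono2) auto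
        finally show False
          using prec by (simp add: prec_beta_def X_beta_def)
      qed
      then show "prec_w w u e f"
        using prec pos[OF e] by (auto simp: prec_w_def prec_beta_def X_beta_def)
    qed
  qed
qed

section \<open>Convergence at one edge\<close>

lemma eventually_mem_F_beta_iff:
  assumes lam: "lam > 1" and pos: "\<And>f. f \<in> E \<Longrightarrow> edge_weight w f > 0"
    and gap: "\<And>f. f \<in> E \<Longrightarrow> edge_weight w f < edge_weight w e
        \<Longrightarrow> lam * edge_weight w f \<le> edge_weight w e"
    and u: "\<And>f. f \<in> E \<Longrightarrow> 0 \<le> u f \<and> u f < 1" and e: "e \<in> E"
  shows "\<forall>\<^sub>F \<beta> in at_top. e \<in> F_beta E w \<beta> u \<longleftrightarrow> e \<in> FMaxSF E w u"
proof (cases "e \<in> FMaxSF E w u")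
  case True
  have "\<forall>\<^sub>F \<beta> in at_top. \<forall>f\<in>E. prec_beta w u \<beta> e f \<longrightarrow> prec_w w u e f"
    by (rule eventually_prec_w_of_prec_beta[OF lam pos gap _ _ e]) (use u e in auto)
  then show ?thesis
  proof eventually_elim
    case (elim \<beta>)
    have "e \<in> F_beta E w \<beta> u"
      unfolding F_beta_def cycle_deletion_def
    proof (intro CollectI conjI e notI)
      assume "\<exists>C. finite_cycle E C \<and> e \<in> C \<and> (\<forall>f\<in>C - {e}. prec_beta w u \<beta> e f)"
      then obtain C where C: "finite_cycle E C" "e \<in> C" "\<forall>f\<in>C - {e}. prec_beta w u \<beta> e f"
        by blast
      have "C \<subseteq> E" using C(1) by (auto simp: finite_cycle_def)
      then have "\<forall>f\<in>C - {e}. prec_w w u e f" using C(3) elim by blast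
      then show False using True C(1,2) by (auto simp: FMaxSF_def cycle_deletion_def)
    qed
    then show ?case using True by simp
  qed
next
  case False
  then obtain C where C: "finite_cycle E C" "e \<in> C" "\<forall>f\<in>C - {e}. prec_w w u e f"
    using e by (auto simp: FMaxSF_def cycle_deletion_def)
  have CE: "C \<subseteq> E" using C(1) by (auto simp: finite_cycle_def)
  have "\<forall>\<^sub>F \<beta> in at_top. \<forall>f\<in>C - {e}. prec_beta w u \<beta> e f"
  proof (rule eventually_ball_finite)
    show "finite (C - {e})" using finite_cycle_imp_finite[OF C(1)] by simp
    show "\<forall>f\<in>C - {e}. \<forall>\<^sub>F \<beta> in at_top. prec_beta w u \<beta> e f"
      using C(3) CE u pos[OF e] by (blast intro: eventually_prec_beta_of_prec_w)
  qed
  then show ?thesis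
    by eventually_elim (use False C in \<open>auto simp: F_beta_def cycle_deletion_def\<close>)
qed

section \<open>The labels and the limit\<close>

text \<open>The value 1 is excluded because an edge with \<open>U f = 1\<close> would have \<open>X_beta\<close> equal to 0 for
  every \<open>\<beta>\<close>, whatever its weight.\<close>

lemma AE_labels_in_unit_interval:
  assumes "prob_space M" "iid_uniform_labels M E U" "countable E"
  shows "AE \<omega> in M. \<forall>f\<in>E. 0 \<le> U f \<omega> \<and> U f \<omega> < 1"
proof (rule AE_ball_countable'[OF _ assms(3)])
  fix f assume f: "f \<in> E"
  have meas: "U f \<in> measurable M borel"
    using assms(1,2) f by (simp add: iid_uniform_labels_def prob_space.indep_vars_def2)
  have "AE x in lborel. x \<in> {0..1} \<longrightarrow> 0 \<le> x \<and> x < (1::real)"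
    using AE_lborel_singleton[of "1::real"] by eventually_elim auto
  then have "AE x in uniform_measure lborel {0..1}. 0 \<le> x \<and> x < (1::real)"
    by (intro AE_uniform_measureI) auto
  moreover have "distr M borel (U f) = uniform_measure lborel {0..1}"
    using assms(2) f by (simp add: iid_uniform_labels_def)
  ultimately have "AE x in distr M borel (U f). 0 \<le> x \<and> x < 1" by metis
  then show "AE \<omega> in M. 0 \<le> U f \<omega> \<and> U f \<omega> < 1"
    by (rule AE_distrD[OF meas])
qed

theorem theorem3p4:
  fixes V :: "'v set" and E :: "'v set set"
    and w :: "'v \<Rightarrow> real" and lam :: real
    and M :: "'s measure" and U :: "'v set \<Rightarrow> 's \<Rightarrow> real"
  assumes "simple_graph V E"
    and "connected_graph V E"
    and "locally_finite_graph V E"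
    and "lam > 1"
    and "\<forall>v\<in>V. w v > 0"
    and "\<forall>v\<in>V. \<exists>n::int. w v = lam powi n"
    and "prob_space M"
    and "iid_uniform_labels M E U"
  shows "as_local_limit M E
           (\<lambda>\<beta> \<omega>. F_beta E w \<beta> (\<lambda>e. U e \<omega>))
           (\<lambda>\<omega>. FMaxSF E w (\<lambda>e. U e \<omega>))"
proof -
  have pos: "edge_weight w f > 0" if "f \<in> E" for f
    using edge_weight_attained[OF assms(1) that] assms(5) by metis
  have pow: "\<exists>n::int. edge_weight w f = lam powi n" if "f \<in> E" for f
    using edge_weight_attained[OF assms(1) that] assms(6) by metis
  have gap: "lam * edge_weight w f \<le> edge_weight w e"
    if "e \<in> E" "f \<in> E" "edge_weight w f < edge_weight w e" for e f
    using pow[OF that(1)] pow[OF that(2)] that(3) powi_less_imp_mult_le[OF assms(4)] by metis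
  have "AE \<omega> in M. \<forall>f\<in>E. 0 \<le> U f \<omega> \<and> U f \<omega> < 1"
    using AE_labels_in_unit_interval[OF assms(7,8)] countable_edges[OF assms(1-3)] by blast
  then show ?thesis
    unfolding as_local_limit_def
  proof eventually_elim
    case (elim \<omega>)
    show ?case
    proof (intro allI impI)
      fix K assume K: "finite K \<and> K \<subseteq> E"
      have "\<forall>\<^sub>F \<beta> in at_top. \<forall>e\<in>K.
          e \<in> F_beta E w \<beta> (\<lambda>e. U e \<omega>) \<longleftrightarrow> e \<in> FMaxSF E w (\<lambda>e. U e \<omega>)"
      proof (intro eventually_ball_finite ballI)
        fix e assume "e \<in> K"
        then have "e \<in> E" using K by blast
        then show "\<forall>\<^sub>F \<beta> in at_top.
            e \<in> F_beta E w \<beta> (\<lambda>e. U e \<omega>) \<longleftrightarrow> e \<in> FMaxSF E w (\<lambda>e. U e \<omega>)"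
          using elim by (intro eventually_mem_F_beta_iff[OF assms(4)] pos gap) auto
      qed (use K in blast)
      then show "\<forall>\<^sub>F \<beta> in at_top.
          F_beta E w \<beta> (\<lambda>e. U e \<omega>) \<inter> K = FMaxSF E w (\<lambda>e. U e \<omega>) \<inter> K"
        by eventually_elim blast
    qed
  qed
qed

end
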